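(* For every $f:\mathcal X\times\mathcal Y\to\{0,1\}^k$ and every $0<\epsilon<\frac12$, $$R^{\mathrm{xor}}_\epsilon(f)\le R^{\mathrm{spt}}_\epsilon(f)\le R^{\mathrm{oot}}_\epsilon(f)\le R^{\mathrm{uni}}_\epsilon(f)\le R^{\mathrm{xor}}_\epsilon(f)+k,$$ and $$D^{\mathrm{xor}}(\mathrm{XOR}_n)=0,\qquad R^{\mathrm{spt}}_\epsilon(\mathrm{XOR}_n)\in\Omega(n).$$
   Context: $\mathrm{XOR}_n:\{0,1\}^n\times\{0,1\}^n\to\{0,1\}^n$ is $\mathrm{XOR}_n(x,y)=(x_i\oplus y_i)_{i\in[n]}$. Two-party communication with private randomness $r_A,r_B$, public randomness $r$, transcript $t_\pi$ (exchanged bits, public randomness excluded), cost = maximum number of bits exchanged. Output models with error $\epsilon$ (correct with probability at least $1-\epsilon$ on every input), with output maps $O_A(t_\pi,r,r_A,x)$, $O_B(t_\pi,r,r_B,y)$: Alice (resp. Bob) — $O_A=f(x,y)$ (resp. $O_B=f(x,y)$); one-out-of-two — values in $\{0,1\}^k\cup\{\top\}$ and $(O_A,O_B)\in\{(f(x,y),\top),(\top,f(x,y))\}$; split — values in $\{0,1,*\}^k$ and $O_A\bowtie O_B=f(x,y)$ where $(a\bowtie b)_i=a_i$ if $b_i=*$, $b_i$ if $a_i=*$, $*$ otherwise; XOR — values in $\{0,1\}^k$ and $O_A\oplus O_B=f(x,y)$ bitwise. $R^{\mathcal M}_\epsilon$ are the minimum costs (public and private coins allowed), $R^{\mathrm{uni}}_\epsilon=\min(R^A_\epsilon,R^B_\epsilon)$,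 $D^{\mathcal M}=R^{\mathcal M}_0$. The $\Omega(n)$ is as $n\to\infty$ for fixed $\epsilon$. *)

theory Defs
  imports "HOL-Probability.Probability" "HOL-Library.Landau_Symbols"
    "HOL-Library.Extended_Nat" "HOL-Library.Extended_Real" "HOL-Library.FuncSet"
begin

definition bitstrings :: "nat \<Rightarrow> bool list set" where
  "bitstrings k = {z. length z = k}"

definition bitwise_xor :: "bool list \<Rightarrow> bool list \<Rightarrow> bool list" where
  "bitwise_xor a b = map2 (\<noteq>) a b"

text \<open>Protocol tree for one value of the public coins. The argument types of the messages are
  instantiated below to (input, private coins) of the player. In each inner node, the first
  subtree is entered on bit \<^term>\<open>False\<close>, the second one on \<^term>\<open>True\<close>.\<close>

datatype ('a, 'b) ptree =
    Halt
  | Alice_sends "'a \<Rightarrow> bool" "('a, 'b) ptree" "('a, 'b) ptree"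
  | Bob_sends "'b \<Rightarrow> bool" "('a, 'b) ptree" "('a, 'b) ptree"

fun run :: "('a, 'b) ptree \<Rightarrow> 'a \<Rightarrow> 'b \<Rightarrow> bool list" where
  "run Halt a b = []"
| "run (Alice_sends m t0 t1) a b = m a # run (if m a then t1 else t0) a b"
| "run (Bob_sends m t0 t1) a b = m b # run (if m b then t1 else t0) a b"

text \<open>The three sources of randomness are arbitrary discrete distributions chosen by the
  protocol; taking \<^typ>\<open>nat\<close> as sample space is no restriction on these, since a
  \<^type>\<open>pmf\<close> has countable support. For finite input sets, arbitrary probability spaces
  would give the same complexities: bounded cost leaves finitely many deterministic strategies.
  The output maps take transcript, public coins, own private coins and own input.\<close>

record ('x, 'y, 'o) protocol =
  pub :: "nat pmf"
  priv_A :: "nat pmf"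
  priv_B :: "nat pmf"
  tree :: "nat \<Rightarrow> ('x \<times> nat, 'y \<times> nat) ptree"
  out_A :: "bool list \<Rightarrow> nat \<Rightarrow> nat \<Rightarrow> 'x \<Rightarrow> 'o"
  out_B :: "bool list \<Rightarrow> nat \<Rightarrow> nat \<Rightarrow> 'y \<Rightarrow> 'o"

definition transcript ::
    "('x, 'y, 'o) protocol \<Rightarrow> nat \<Rightarrow> nat \<Rightarrow> nat \<Rightarrow> 'x \<Rightarrow> 'y \<Rightarrow> bool list" where
  "transcript P r rA rB x y = run (tree P r) (x, rA) (y, rB)"

definition cost :: "'x set \<Rightarrow> 'y set \<Rightarrow> ('x, 'y, 'o) protocol \<Rightarrow> enat" where
  "cost X Y P = Sup {enat (length (transcript P r rA rB x y)) | r rA rB x y.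
     r \<in> set_pmf (pub P) \<and> rA \<in> set_pmf (priv_A P) \<and> rB \<in> set_pmf (priv_B P) \<and> x \<in> X \<and> y \<in> Y}"

text \<open>An output model consists of the values the players may output and of the condition under
  which a pair of outputs of Alice and Bob is correct for the value \<open>z\<close> of the function.\<close>

record 'o output_model =
  vals :: "'o set"
  correct :: "'o \<Rightarrow> 'o \<Rightarrow> bool list \<Rightarrow> bool"

definition success_prob ::
    "'o output_model \<Rightarrow> ('x \<Rightarrow> 'y \<Rightarrow> bool list) \<Rightarrow> ('x, 'y, 'o) protocol \<Rightarrow> 'x \<Rightarrow> 'y \<Rightarrow> real" where
  "success_prob M f P x y =
     measure_pmf.prob (pair_pmf (pub P) (pair_pmf (priv_A P) (priv_B P)))
       {(r, rA, rB). let t = transcript P r rA rB x y in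
          correct M (out_A P t r rA x) (out_B P t r rB y) (f x y)}"

definition computes ::
    "'x set \<Rightarrow> 'y set \<Rightarrow> 'o output_model \<Rightarrow> ('x \<Rightarrow> 'y \<Rightarrow> bool list) \<Rightarrow> real
      \<Rightarrow> ('x, 'y, 'o) protocol \<Rightarrow> bool" where
  "computes X Y M f \<epsilon> P \<longleftrightarrow>
     (\<forall>t r rA. \<forall>x\<in>X. out_A P t r rA x \<in> vals M) \<and>
     (\<forall>t r rB. \<forall>y\<in>Y. out_B P t r rB y \<in> vals M) \<and>
     (\<forall>x\<in>X. \<forall>y\<in>Y. success_prob M f P x y \<ge> 1 - \<epsilon>)"

text \<open>The value is \<open>\<infinity>\<close> iff no protocol of finite cost exists (possible for infinite
  \<open>X\<close>, \<open>Y\<close>); otherwise the infimum is a minimum.\<close>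

definition R :: "'x set \<Rightarrow> 'y set \<Rightarrow> 'o output_model \<Rightarrow> ('x \<Rightarrow> 'y \<Rightarrow> bool list) \<Rightarrow> real \<Rightarrow> enat" where
  "R X Y M f \<epsilon> = Inf {cost X Y P | P. computes X Y M f \<epsilon> P}"

text \<open>In the two unilateral models the output of the other player is ignored.\<close>

definition alice_model :: "nat \<Rightarrow> bool list output_model" where
  "alice_model k = \<lparr>vals = bitstrings k, correct = (\<lambda>a b z. a = z)\<rparr>"

definition bob_model :: "nat \<Rightarrow> bool list output_model" where
  "bob_model k = \<lparr>vals = bitstrings k, correct = (\<lambda>a b z. b = z)\<rparr>"

text \<open>\<^term>\<open>None\<close> stands for \<open>\<top>\<close> in the one-out-of-two model, and for the symbol \<open>*\<close> in the
  split model.\<close>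

definition oot_model :: "nat \<Rightarrow> bool list option output_model" where
  "oot_model k = \<lparr>vals = Some ` bitstrings k \<union> {None},
     correct = (\<lambda>a b z. (a, b) \<in> {(Some z, None), (None, Some z)})\<rparr>"

definition weave :: "bool option list \<Rightarrow> bool option list \<Rightarrow> bool option list" (infixl "\<bowtie>" 65) where
  "a \<bowtie> b = map2 (\<lambda>u v. if v = None then u else if u = None then v else None) a b"

definition split_model :: "nat \<Rightarrow> bool option list output_model" where
  "split_model k = \<lparr>vals = {a. length a = k}, correct = (\<lambda>a b z. a \<bowtie> b = map Some z)\<rparr>"

definition xor_model :: "nat \<Rightarrow> bool list output_model" where
  "xor_model k = \<lparr>vals = bitstrings k, correct = (\<lambda>a b z. bitwise_xor a b = z)\<rparr>"

definition R_A where "R_A X Y k f \<epsilon> = R X Y (alice_model k) f \<epsilon>"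
definition R_B where "R_B X Y k f \<epsilon> = R X Y (bob_model k) f \<epsilon>"
definition R_uni where "R_uni X Y k f \<epsilon> = min (R_A X Y k f \<epsilon>) (R_B X Y k f \<epsilon>)"
definition R_oot where "R_oot X Y k f \<epsilon> = R X Y (oot_model k) f \<epsilon>"
definition R_spt where "R_spt X Y k f \<epsilon> = R X Y (split_model k) f \<epsilon>"
definition R_xor where "R_xor X Y k f \<epsilon> = R X Y (xor_model k) f \<epsilon>"
definition D_xor where "D_xor X Y k f = R_xor X Y k f 0"

text \<open>\<open>XOR_fun\<close> is used on \<open>bitstrings n \<times> bitstrings n\<close>, with values in \<open>bitstrings n\<close>.\<close>

definition XOR_fun :: "nat \<Rightarrow> bool list \<Rightarrow> bool list \<Rightarrow> bool list" where
  "XOR_fun n x y = map (\<lambda>i. x ! i \<noteq> y ! i) [0..<n]"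

end

(* Changing the output model is relabelling of outputs; for the last inequality of the chain, Bob
   appends the k bits of his output to the conversation.

   Lower bound: put the uniform distribution on the inputs and fix the best coins. In a correct split
   output each bit is announced by exactly one player, so one of the two announces at least n/2 bits.
   If it is Alice, then x and the transcript determine x_i XOR y_i, hence y_i, at n/2 positions,
   leaving at most 2^(n/2) inputs y. Summing over the fewer than 2^(c+1) possible transcripts, at most
   2^(c+1) * 2 * 2^n * 2^(n/2) input pairs are answered correctly, but more than 4^n / 2 have to be. *)

theory Submission
  imports Defs
begin

section \<open>Simulation between output models\<close>

text \<open>The infimum of the empty set is infinity, so the hypothesis leaves a nonempty set of
  costs. The well-ordering of \<open>enat\<close> makes its infimum a member.\<close>

lemma R_attained:
  assumes "R X Y M f \<epsilon> \<noteq> \<infinity>"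
  obtains P where "computes X Y M f \<epsilon> P" "cost X Y P = R X Y M f \<epsilon>"
proof -
  let ?C = "{cost X Y P | P. computes X Y M f \<epsilon> P}"
  have "Inf ?C \<noteq> \<infinity>" using assms by (simp only: R_def not_False_eq_True)
  then have "?C \<noteq> {}" unfolding Inf_enat_def by (metis (lifting))
  then have "\<exists>c. c \<in> ?C" by (simp only: ex_in_conv not_False_eq_True)
  then have "(LEAST c. c \<in> ?C) \<in> ?C" by (rule LeastI_ex)
  then have "Inf ?C \<in> ?C" using \<open>?C \<noteq> {}\<close> unfolding Inf_enat_def by (simp only: if_False)
  then show thesis using that by (auto simp: R_def)
qed

lemma R_le_cost: "computes X Y M f \<epsilon> P \<Longrightarrow> R X Y M f \<epsilon> \<le> cost X Y P"
  unfolding R_def by (intro Inf_lower) blast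

text \<open>Turns a transformation of protocols with overhead \<open>d\<close> into a comparison of
  complexities, by applying it to an optimal protocol. An infinite right-hand side is
  trivial.\<close>

lemma R_le_R_plusI:
  assumes "\<And>P. computes X Y M f \<epsilon> P \<Longrightarrow>
             \<exists>Q. computes X Y M' f \<epsilon>' Q \<and> cost X Y Q \<le> cost X Y P + d"
  shows "R X Y M' f \<epsilon>' \<le> R X Y M f \<epsilon> + d"
proof (cases "R X Y M f \<epsilon> = \<infinity>")
  case False
  then obtain P where "computes X Y M f \<epsilon> P" "cost X Y P = R X Y M f \<epsilon>"
    by (rule R_attained)
  with assms show ?thesis by (metis R_le_cost order_trans)
qed simp

text \<open>Equal coin distributions put both success events in one probability space, so inclusion
  of events suffices. The trees may differ, which is needed when the conversation is
  prolonged.\<close>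

lemma success_prob_mono:
  assumes "pub Q = pub P" "priv_A Q = priv_A P" "priv_B Q = priv_B P"
    and "\<And>r rA rB. correct M
            (out_A P (transcript P r rA rB x y) r rA x)
            (out_B P (transcript P r rA rB x y) r rB y) (f x y) \<Longrightarrow>
          correct M'
            (out_A Q (transcript Q r rA rB x y) r rA x)
            (out_B Q (transcript Q r rA rB x y) r rB y) (f x y)"
  shows "success_prob M f P x y \<le> success_prob M' f Q x y"
  unfolding success_prob_def assms(1-3)
  by (rule measure_pmf.finite_measure_mono) (use assms(4) in \<open>auto simp: Let_def\<close>)

text \<open>Composing the output maps with \<open>gA\<close> and \<open>gB\<close> touches neither
  the tree nor the coins, so transcripts and cost stay the same.\<close>

lemma R_le_by_relabelling:
  assumes f: "f \<in> X \<rightarrow> Y \<rightarrow> bitstrings k"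
    and vals: "gA ` vals M \<subseteq> vals M'" "gB ` vals M \<subseteq> vals M'"
    and correct: "\<And>a b z. a \<in> vals M \<Longrightarrow> b \<in> vals M \<Longrightarrow> length z = k \<Longrightarrow> correct M a b z \<Longrightarrow>
                    correct M' (gA a) (gB b) z"
  shows "R X Y M' f \<epsilon> \<le> R X Y M f \<epsilon>"
proof -
  have "R X Y M' f \<epsilon> \<le> R X Y M f \<epsilon> + 0"
  proof (rule R_le_R_plusI)
    fix P
    assume P: "computes X Y M f \<epsilon> P"
    define Q where "Q = \<lparr>pub = pub P, priv_A = priv_A P, priv_B = priv_B P, tree = tree P,
      out_A = (\<lambda>t r rA x. gA (out_A P t r rA x)), out_B = (\<lambda>t r rB y. gB (out_B P t r rB y))\<rparr>"
    have tr: "transcript Q = transcript P"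
      by (simp add: transcript_def Q_def fun_eq_iff)
    have "success_prob M f P x y \<le> success_prob M' f Q x y" if "x \<in> X" "y \<in> Y" for x y
    proof (rule success_prob_mono)
      have "length (f x y) = k" using f that by (auto simp: bitstrings_def)
      then show "correct M' (out_A Q (transcript Q r rA rB x y) r rA x)
            (out_B Q (transcript Q r rA rB x y) r rB y) (f x y)"
        if "correct M (out_A P (transcript P r rA rB x y) r rA x)
            (out_B P (transcript P r rA rB x y) r rB y) (f x y)" for r rA rB
        using that P \<open>x \<in> X\<close> \<open>y \<in> Y\<close> unfolding tr
        by (auto simp: Q_def computes_def intro!: correct)
    qed (simp_all add: Q_def)
    then have "\<forall>x\<in>X. \<forall>y\<in>Y. success_prob M' f Q x y \<ge> 1 - \<epsilon>"
      using P unfolding computes_def by (meson order_trans)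
    then have "computes X Y M' f \<epsilon> Q"
      using P vals unfolding computes_def by (simp add: Q_def image_subset_iff)
    moreover have "cost X Y Q = cost X Y P"
      unfolding cost_def tr by (simp add: Q_def)
    ultimately show "\<exists>Q. computes X Y M' f \<epsilon> Q \<and> cost X Y Q \<le> cost X Y P + 0" by auto
  qed
  then show ?thesis by simp
qed

text \<open>The weave is \<open>None\<close> at a position both if neither player announces and if
  both do. A \<open>Some\<close> therefore certifies exactly one announcement.\<close>

lemma weave_eq_map_Some_iff:
  assumes "length a = n" "length b = n" "length z = n"
  shows "a \<bowtie> b = map Some z \<longleftrightarrow>
    (\<forall>i<n. a ! i = Some (z ! i) \<and> b ! i = None \<or> a ! i = None \<and> b ! i = Some (z ! i))"
  using assms by (auto simp: weave_def list_eq_iff_nth_eq split: if_splits)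

lemma weave_commute: "length a = length b \<Longrightarrow> a \<bowtie> b = b \<bowtie> a"
  by (auto simp: weave_def list_eq_iff_nth_eq)

text \<open>The silent symbol becomes \<open>False\<close>, the neutral element of XOR, so at each
  position only the announced bit survives.\<close>

lemma R_xor_le_R_spt:
  assumes "f \<in> X \<rightarrow> Y \<rightarrow> bitstrings k"
  shows "R_xor X Y k f \<epsilon> \<le> R_spt X Y k f \<epsilon>"
  unfolding R_xor_def R_spt_def
proof (rule R_le_by_relabelling[OF assms,
    where gA = "map (\<lambda>u. u = Some True)" and gB = "map (\<lambda>u. u = Some True)"])
  fix a b z
  assume "a \<in> vals (split_model k)" "b \<in> vals (split_model k)" "length z = k"
    and "correct (split_model k) a b z"
  then have len: "length a = k" "length b = k" "length z = k" and "a \<bowtie> b = map Some z"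
    by (simp_all add: split_model_def)
  then have "((a ! i = Some True) \<noteq> (b ! i = Some True)) = z ! i" if "i < k" for i
    using that by (auto simp: weave_eq_map_Some_iff)
  then show "correct (xor_model k) (map (\<lambda>u. u = Some True) a) (map (\<lambda>u. u = Some True) b) z"
    using len by (simp add: xor_model_def bitwise_xor_def list_eq_iff_nth_eq)
qed (auto simp: split_model_def xor_model_def bitstrings_def)

text \<open>A player answering \<open>None\<close> becomes silent at all \<open>k\<close> positions,
  and the other one announces the whole value.\<close>

lemma R_spt_le_R_oot:
  assumes "f \<in> X \<rightarrow> Y \<rightarrow> bitstrings k"
  shows "R_spt X Y k f \<epsilon> \<le> R_oot X Y k f \<epsilon>"
proof -
  let ?g = "case_option (replicate k None) (map Some)"
  show ?thesis
    unfolding R_spt_def R_oot_def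
    by (rule R_le_by_relabelling[OF assms, where gA = ?g and gB = ?g])
      (auto simp: split_model_def oot_model_def bitstrings_def weave_eq_map_Some_iff)
qed

lemma R_oot_le_R_uni:
  assumes "f \<in> X \<rightarrow> Y \<rightarrow> bitstrings k"
  shows "R_oot X Y k f \<epsilon> \<le> R_uni X Y k f \<epsilon>"
proof -
  have "R_oot X Y k f \<epsilon> \<le> R_A X Y k f \<epsilon>"
    unfolding R_oot_def R_A_def
    by (rule R_le_by_relabelling[OF assms, where gA = Some and gB = "\<lambda>_. None"])
      (auto simp: alice_model_def oot_model_def)
  moreover have "R_oot X Y k f \<epsilon> \<le> R_B X Y k f \<epsilon>"
    unfolding R_oot_def R_B_def
    by (rule R_le_by_relabelling[OF assms, where gA = "\<lambda>_. None" and gB = Some])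
      (auto simp: bob_model_def oot_model_def)
  ultimately show ?thesis by (simp add: R_uni_def)
qed

section \<open>Prolonging a conversation by Bob's output\<close>

fun extend_tree :: "('a, 'b) ptree \<Rightarrow> (bool list \<Rightarrow> ('a, 'b) ptree) \<Rightarrow> ('a, 'b) ptree" where
  "extend_tree Halt K = K []"
| "extend_tree (Alice_sends m t0 t1) K =
     Alice_sends m (extend_tree t0 (\<lambda>s. K (False # s))) (extend_tree t1 (\<lambda>s. K (True # s)))"
| "extend_tree (Bob_sends m t0 t1) K =
     Bob_sends m (extend_tree t0 (\<lambda>s. K (False # s))) (extend_tree t1 (\<lambda>s. K (True # s)))"

text \<open>The continuation \<open>K\<close> receives the whole first transcript, because Bob's
  output depends on it. Descending the tree moves bits into \<open>K\<close>, hence the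
  generalization over \<open>K\<close>.\<close>

lemma run_extend_tree: "run (extend_tree T K) a b = run T a b @ run (K (run T a b)) a b"
  by (induction T arbitrary: K) auto

text \<open>Both subtrees coincide because no later message depends on the bits just sent.\<close>

definition bob_sends_all :: "('b \<Rightarrow> bool) list \<Rightarrow> ('a, 'b) ptree" where
  "bob_sends_all ms = foldr (\<lambda>m t. Bob_sends m t t) ms Halt"

lemma run_bob_sends_all: "run (bob_sends_all ms) a b = map (\<lambda>m. m b) ms"
  by (induction ms) (auto simp: bob_sends_all_def)

text \<open>Once Bob's output is part of the transcript, Alice XORs it with her own; every coin
  outcome that was correct before stays correct.\<close>

lemma R_A_le_R_xor:
  assumes f: "f \<in> X \<rightarrow> Y \<rightarrow> bitstrings k"
  shows "R_A X Y k f \<epsilon> \<le> R_xor X Y k f \<epsilon> + enat k"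
  unfolding R_A_def R_xor_def
proof (rule R_le_R_plusI)
  fix P :: "('a, 'b, bool list) protocol"
  assume P: "computes X Y (xor_model k) f \<epsilon> P"
  define msgs where "msgs r t =
    map (\<lambda>i (y, rB). out_B P t r rB y ! i) [0..<k]" for r t
  \<comment> \<open>The appended block always has \<open>k\<close> bits, so cutting at
    \<open>length t - k\<close> recovers the transcript of \<open>P\<close> although its length may
    vary.\<close>
  define Q where "Q = P\<lparr>
    tree := (\<lambda>r. extend_tree (tree P r) (\<lambda>t. bob_sends_all (msgs r t))),
    out_A := (\<lambda>t r rA x.
      let a = out_A P (take (length t - k) t) r rA x; b = drop (length t - k) t
      in map (\<lambda>i. a ! i \<noteq> b ! i) [0..<k])\<rparr>"
  have tr: "transcript Q r rA rB x y = transcript P r rA rB x y @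
      map (\<lambda>i. out_B P (transcript P r rA rB x y) r rB y ! i) [0..<k]" for r rA rB x y
    by (simp add: transcript_def Q_def run_extend_tree run_bob_sends_all msgs_def)
  have coins: "pub Q = pub P" "priv_A Q = priv_A P" "priv_B Q = priv_B P"
    by (simp_all add: Q_def)
  have "success_prob (xor_model k) f P x y \<le> success_prob (alice_model k) f Q x y"
    if xy: "x \<in> X" "y \<in> Y" for x y
  proof (rule success_prob_mono)
    fix r rA rB
    let ?t = "transcript P r rA rB x y"
    assume "correct (xor_model k) (out_A P ?t r rA x) (out_B P ?t r rB y) (f x y)"
    then have "f x y = map2 (\<noteq>) (out_A P ?t r rA x) (out_B P ?t r rB y)"
      by (simp add: xor_model_def bitwise_xor_def)
    moreover have "length (out_A P ?t r rA x) = k" "length (out_B P ?t r rB y) = k"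
      using P xy by (auto simp: computes_def xor_model_def bitstrings_def)
    moreover have "out_A Q (transcript Q r rA rB x y) r rA x =
        map (\<lambda>i. out_A P ?t r rA x ! i \<noteq> out_B P ?t r rB y ! i) [0..<k]"
      unfolding tr by (simp add: Q_def)
    ultimately have "out_A Q (transcript Q r rA rB x y) r rA x = f x y"
      by (auto intro!: nth_equalityI)
    then show "correct (alice_model k) (out_A Q (transcript Q r rA rB x y) r rA x)
        (out_B Q (transcript Q r rA rB x y) r rB y) (f x y)"
      by (simp add: alice_model_def)
  qed (fact coins)+
  then have "\<forall>x\<in>X. \<forall>y\<in>Y. success_prob (alice_model k) f Q x y \<ge> 1 - \<epsilon>"
    using P unfolding computes_def by (meson order_trans)
  \<comment> \<open>\<open>computes\<close> constrains the outputs for every list \<open>t\<close>,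
    even one too short for the cut. There \<open>!\<close> yields unspecified bits, but the length
    is still \<open>k\<close>.\<close>
  moreover have "out_A Q t r rA x \<in> bitstrings k" for t r rA x
    by (simp add: Q_def bitstrings_def Let_def)
  moreover have "out_B Q = out_B P" by (simp add: Q_def)
  ultimately have "computes X Y (alice_model k) f \<epsilon> Q"
    using P unfolding computes_def by (simp add: alice_model_def xor_model_def)
  moreover have "cost X Y Q \<le> cost X Y P + enat k"
    unfolding cost_def[of X Y Q]
  proof (rule Sup_least)
    fix c
    assume "c \<in> {enat (length (transcript Q r rA rB x y)) |r rA rB x y. r \<in> set_pmf (pub Q) \<and>
      rA \<in> set_pmf (priv_A Q) \<and> rB \<in> set_pmf (priv_B Q) \<and> x \<in> X \<and> y \<in> Y}"
    then obtain r rA rB x y where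
      c: "c = enat (length (transcript P r rA rB x y)) + enat k" and
      "r \<in> set_pmf (pub P)" "rA \<in> set_pmf (priv_A P)" "rB \<in> set_pmf (priv_B P)" "x \<in> X" "y \<in> Y"
      by (auto simp: tr coins)
    then have "enat (length (transcript P r rA rB x y)) \<le> cost X Y P"
      unfolding cost_def by (intro Sup_upper) blast
    then show "c \<le> cost X Y P + enat k" unfolding c by (rule add_right_mono)
  qed
  ultimately show "\<exists>Q. computes X Y (alice_model k) f \<epsilon> Q \<and> cost X Y Q \<le> cost X Y P + enat k"
    by blast
qed

lemma R_uni_le_R_xor:
  assumes "f \<in> X \<rightarrow> Y \<rightarrow> bitstrings k"
  shows "R_uni X Y k f \<epsilon> \<le> R_xor X Y k f \<epsilon> + enat k"
  using R_A_le_R_xor[OF assms] by (simp add: R_uni_def min.coboundedI1)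

section \<open>The XOR function\<close>

lemma XOR_fun_in: "XOR_fun n \<in> bitstrings n \<rightarrow> bitstrings n \<rightarrow> bitstrings n"
  by (auto simp: XOR_fun_def bitstrings_def)

lemma XOR_fun_commute: "XOR_fun n x y = XOR_fun n y x"
  by (auto simp: XOR_fun_def)

text \<open>Each player silently outputs the own input. Error 0 gives \<open>D_xor\<close>; positive
  errors give the finiteness needed in \<open>R_spt_XOR_bounds\<close>.\<close>

lemma R_xor_XOR:
  assumes "0 \<le> \<epsilon>"
  shows "R_xor (bitstrings n) (bitstrings n) n (XOR_fun n) \<epsilon> = 0"
proof -
  define P :: "(bool list, bool list, bool list) protocol" where
    "P = \<lparr>pub = return_pmf 0, priv_A = return_pmf 0, priv_B = return_pmf 0, tree = (\<lambda>_. Halt),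
      out_A = (\<lambda>_ _ _ x. x), out_B = (\<lambda>_ _ _ y. y)\<rparr>"
  have "bitwise_xor x y = XOR_fun n x y" if "x \<in> bitstrings n" "y \<in> bitstrings n" for x y
    using that by (auto simp: bitwise_xor_def XOR_fun_def bitstrings_def list_eq_iff_nth_eq)
  then have "computes (bitstrings n) (bitstrings n) (xor_model n) (XOR_fun n) \<epsilon> P"
    using assms by (simp add: computes_def P_def xor_model_def success_prob_def)
  then have "R_xor (bitstrings n) (bitstrings n) n (XOR_fun n) \<epsilon>
      \<le> cost (bitstrings n) (bitstrings n) P"
    unfolding R_xor_def by (rule R_le_cost)
  also have "\<dots> \<le> 0"
    unfolding cost_def by (rule Sup_least) (auto simp: transcript_def P_def zero_enat_def)
  finally show ?thesis by simp
qed

section \<open>Cardinalities of sets of bit strings\<close>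

lemma bitstrings_finite: "finite (bitstrings n)"
  and card_bitstrings: "card (bitstrings n) = 2 ^ n"
  using finite_lists_length_eq[of "UNIV :: bool set" n] card_lists_length_eq[of "UNIV :: bool set" n]
  by (simp_all add: bitstrings_def)

lemma card_short_bitstrings: "card {t :: bool list. length t \<le> c} \<le> 2 ^ (c + 1)"
proof -
  have "card {t :: bool list. length t \<le> c} = (\<Sum>i\<le>c. 2 ^ i)"
    using card_lists_length_le[of "UNIV :: bool set" c] by simp
  also have "\<dots> \<le> 2 ^ (c + 1)" by (induction c) auto
  finally show ?thesis .
qed

text \<open>With the positions in \<open>S\<close> prescribed, a string is determined by the set of
  its \<open>True\<close> positions outside \<open>S\<close>.\<close>

lemma card_bitstrings_fixed_le:
  assumes "S \<subseteq> {..<n}"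
  shows "card {y \<in> bitstrings n. \<forall>i\<in>S. y ! i = w i} \<le> 2 ^ (n - card S)"
proof -
  let ?A = "{y \<in> bitstrings n. \<forall>i\<in>S. y ! i = w i}" and ?h = "\<lambda>y. {i \<in> {..<n} - S. y ! i}"
  have "inj_on ?h ?A"
  proof (rule inj_onI)
    fix y y'
    assume y: "y \<in> ?A" "y' \<in> ?A" and eq: "?h y = ?h y'"
    have "y ! i = y' ! i" if "i < n" for i
      using y eq that by (cases "i \<in> S") auto
    then show "y = y'" using y by (auto simp: bitstrings_def list_eq_iff_nth_eq)
  qed
  then have "card ?A \<le> card (Pow ({..<n} - S))"
    by (rule card_inj_on_le) auto
  also have "\<dots> = 2 ^ (n - card S)"
    using assms by (simp add: card_Pow card_Diff_subset finite_subset)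
  finally show ?thesis .
qed

section \<open>The counting lower bound in the split model\<close>

definition announced :: "bool option list \<Rightarrow> nat set" where
  "announced a = {i. i < length a \<and> a ! i \<noteq> None}"

text \<open>In a correct split output the two announced sets partition the positions.\<close>

lemma card_announced_add:
  assumes "length a = n" "length b = n" "length z = n" "a \<bowtie> b = map Some z"
  shows "card (announced a) + card (announced b) = n"
proof -
  have "announced b = {..<n} - announced a"
    using assms by (auto simp: weave_eq_map_Some_iff announced_def)
  moreover have sub: "announced a \<subseteq> {..<n}" using assms by (auto simp: announced_def)
  ultimately have "card (announced b) = n - card (announced a)"
    by (simp add: card_Diff_subset finite_subset)
  moreover have "card (announced a) \<le> n" using card_mono[OF _ sub] by simp
  ultimately show ?thesis by simp
qed

text \<open>Each bit announced in \<open>a\<close> equals \<open>x ! i\<close> XOR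
  \<open>y ! i\<close>, and XOR with the known \<open>x ! i\<close> recovers \<open>y ! i\<close>.
  The other output may still vary with \<open>y\<close>.\<close>

lemma card_correct_le:
  assumes a: "length a = n" and b: "\<And>y. y \<in> bitstrings n \<Longrightarrow> length (b y) = n"
    and half: "n \<le> 2 * card (announced a)"
  shows "card {y \<in> bitstrings n. a \<bowtie> b y = map Some (XOR_fun n x y)} \<le> 2 ^ (n div 2)"
proof -
  have "{y \<in> bitstrings n. a \<bowtie> b y = map Some (XOR_fun n x y)}
      \<subseteq> {y \<in> bitstrings n. \<forall>i\<in>announced a. y ! i = (the (a ! i) \<noteq> x ! i)}"
  proof (intro subsetI CollectI conjI ballI)
    fix y i
    assume "y \<in> {y \<in> bitstrings n. a \<bowtie> b y = map Some (XOR_fun n x y)}"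
      and i: "i \<in> announced a"
    then have y: "y \<in> bitstrings n" "a \<bowtie> b y = map Some (XOR_fun n x y)" by auto
    from y(2) have "a ! i = Some (x ! i \<noteq> y ! i)"
      using weave_eq_map_Some_iff[OF a b[OF y(1)], of "XOR_fun n x y"] i a
      by (auto simp: XOR_fun_def announced_def)
    then show "y ! i = (the (a ! i) \<noteq> x ! i)" by auto
  qed auto
  then have "card {y \<in> bitstrings n. a \<bowtie> b y = map Some (XOR_fun n x y)}
      \<le> card {y \<in> bitstrings n. \<forall>i\<in>announced a. y ! i = (the (a ! i) \<noteq> x ! i)}"
    by (intro card_mono) (simp_all add: bitstrings_finite)
  also have "\<dots> \<le> 2 ^ (n - card (announced a))"
    using a by (intro card_bitstrings_fixed_le) (auto simp: announced_def)
  \<comment> \<open>At least half of the positions, rounded up, are announced, so at most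
    \<open>n div 2\<close> remain free.\<close>
  also have "\<dots> \<le> 2 ^ (n div 2)" using half by (intro power_increasing) auto
  finally show ?thesis .
qed

text \<open>For a fixed transcript Alice's output depends on \<open>x\<close> alone and Bob's on
  \<open>y\<close> alone. The correct pairs are covered according to which player announces at least
  half of the bits.\<close>

lemma card_correct_pairs_le:
  assumes a: "\<And>x. x \<in> bitstrings n \<Longrightarrow> length (a x) = n"
    and b: "\<And>y. y \<in> bitstrings n \<Longrightarrow> length (b y) = n"
  shows "card {(x, y) \<in> bitstrings n \<times> bitstrings n. a x \<bowtie> b y = map Some (XOR_fun n x y)}
    \<le> 2 * (2 ^ n * 2 ^ (n div 2))"
proof -
  let ?B = "bitstrings n"
  define SA where "SA = Sigma {x \<in> ?B. n \<le> 2 * card (announced (a x))}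
    (\<lambda>x. {y \<in> ?B. a x \<bowtie> b y = map Some (XOR_fun n x y)})"
  \<comment> \<open>Bob's input comes first here, so that \<open>card_correct_le\<close> applies
    with the players exchanged; commutativity of weave and XOR permits this.\<close>
  define SB where "SB = Sigma {y \<in> ?B. n \<le> 2 * card (announced (b y))}
    (\<lambda>y. {x \<in> ?B. b y \<bowtie> a x = map Some (XOR_fun n y x)})"
  have card_Sigma_le: "card (Sigma {x \<in> ?B. p x} C) \<le> 2 ^ n * 2 ^ (n div 2)"
    if "\<And>x. x \<in> ?B \<Longrightarrow> p x \<Longrightarrow> C x \<subseteq> ?B \<and> card (C x) \<le> 2 ^ (n div 2)"
    for p and C :: "bool list \<Rightarrow> bool list set"
  proof -
    have "card (Sigma {x \<in> ?B. p x} C) = (\<Sum>x\<in>{x \<in> ?B. p x}. card (C x))"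
      using that bitstrings_finite by (intro card_SigmaI) (auto intro: finite_subset)
    also have "\<dots> \<le> card {x \<in> ?B. p x} * 2 ^ (n div 2)"
      using that sum_bounded_above[of "{x \<in> ?B. p x}" "\<lambda>x. card (C x)" "2 ^ (n div 2)"] by simp
    also have "\<dots> \<le> card ?B * 2 ^ (n div 2)"
      by (intro mult_right_mono card_mono) (auto simp: bitstrings_finite)
    finally show ?thesis by (simp add: card_bitstrings)
  qed
  have fin: "finite SA" "finite SB"
    by (auto simp: SA_def SB_def bitstrings_finite)
  have "{(x, y) \<in> ?B \<times> ?B. a x \<bowtie> b y = map Some (XOR_fun n x y)} \<subseteq> SA \<union> prod.swap ` SB"
  proof clarify
    fix x y
    assume xy: "x \<in> ?B" "y \<in> ?B" "a x \<bowtie> b y = map Some (XOR_fun n x y)" "(x, y) \<notin> prod.swap ` SB"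
    have len: "length (a x) = n" "length (b y) = n" using a b xy by auto
    then have "card (announced (a x)) + card (announced (b y)) = n"
      using xy by (intro card_announced_add[where z = "XOR_fun n x y"]) (auto simp: XOR_fun_def)
    moreover have "\<not> n \<le> 2 * card (announced (b y))"
    proof
      assume "n \<le> 2 * card (announced (b y))"
      then have "(y, x) \<in> SB"
        using xy len weave_commute[of "a x" "b y"] XOR_fun_commute[of n x y] by (auto simp: SB_def)
      then show False using xy(4) by force
    qed
    ultimately show "(x, y) \<in> SA" using xy by (auto simp: SA_def)
  qed
  then have "card {(x, y) \<in> ?B \<times> ?B. a x \<bowtie> b y = map Some (XOR_fun n x y)}
      \<le> card (SA \<union> prod.swap ` SB)"
    using fin by (intro card_mono) auto
  also have "\<dots> \<le> card SA + card SB"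
    using card_Un_le[of SA "prod.swap ` SB"] card_image_le[OF fin(2), of prod.swap] by linarith
  also have "card SA \<le> 2 ^ n * 2 ^ (n div 2)"
    unfolding SA_def using a b by (intro card_Sigma_le conjI card_correct_le) auto
  also have "card SB \<le> 2 ^ n * 2 ^ (n div 2)"
    unfolding SB_def using a b by (intro card_Sigma_le conjI card_correct_le) auto
  finally show ?thesis by simp
qed

text \<open>By linearity, the sum is the expected number of indices whose event occurs, and
  \<open>N\<close> bounds this number at every outcome in the support. This stands in for fixing the
  best coins.\<close>

lemma sum_prob_le:
  fixes p :: "'a pmf"
  assumes "finite I" and "\<And>\<omega>. \<omega> \<in> set_pmf p \<Longrightarrow> card {i \<in> I. \<omega> \<in> E i} \<le> N"
  shows "(\<Sum>i\<in>I. measure_pmf.prob p (E i)) \<le> real N"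
proof -
  have "(\<Sum>i\<in>I. measure_pmf.prob p (E i)) = (\<Sum>i\<in>I. \<integral>\<omega>. indicator (E i) \<omega> \<partial>measure_pmf p)"
    by simp
  also have "\<dots> = (\<integral>\<omega>. (\<Sum>i\<in>I. indicator (E i) \<omega>) \<partial>measure_pmf p)"
    by (intro Bochner_Integration.integral_sum[symmetric]) (simp add: measure_pmf.integrable_const_bound[where B = 1])
  also have "\<dots> \<le> (\<integral>\<omega>. real N \<partial>measure_pmf p)"
  proof (rule integral_mono_AE)
    have "(\<Sum>i\<in>I. indicator (E i) \<omega>) \<le> real N" if "\<omega> \<in> set_pmf p" for \<omega>
    proof -
      have "(\<Sum>i\<in>I. indicator (E i) \<omega>) = real (card {i \<in> I. \<omega> \<in> E i})"
        using assms(1) by (simp add: indicator_def sum.If_cases Int_def)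
      then show ?thesis using assms(2)[OF that] by simp
    qed
    then show "AE \<omega> in measure_pmf p. (\<Sum>i\<in>I. indicator (E i) \<omega>) \<le> real N"
      by (simp add: AE_measure_pmf_iff)
  qed (auto intro!: Bochner_Integration.integrable_sum measure_pmf.integrable_const_bound[where B = 1])
  finally show ?thesis by simp
qed

text \<open>Summing success probabilities over all inputs gives at least half of
  \<open>2 ^ (2 * n)\<close>, while every coin outcome answers at most \<open>N\<close> pairs
  correctly.\<close>

lemma cost_split_XOR_ge:
  assumes "\<epsilon> < 1 / 2"
    and P: "computes (bitstrings n) (bitstrings n) (split_model n) (XOR_fun n) \<epsilon> P"
    and cost: "cost (bitstrings n) (bitstrings n) P \<le> enat c"
  shows "n \<le> 2 * c + 6"
proof -
  let ?B = "bitstrings n"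
  let ?p = "pair_pmf (pub P) (pair_pmf (priv_A P) (priv_B P))"
  define E where "E = (\<lambda>(x, y). {(r, rA, rB). let t = transcript P r rA rB x y in
    correct (split_model n) (out_A P t r rA x) (out_B P t r rB y) (XOR_fun n x y)})"
  define N :: nat where "N = 2 ^ (c + 1) * (2 * (2 ^ n * 2 ^ (n div 2)))"
  have "card {i \<in> ?B \<times> ?B. \<omega> \<in> E i} \<le> N" if \<omega>: "\<omega> \<in> set_pmf ?p" for \<omega>
  proof -
    obtain r rA rB where w: "\<omega> = (r, rA, rB)" by (cases \<omega>)
    \<comment> \<open>Outputs are evaluated at \<open>t\<close> whether or not \<open>(x, y)\<close>
      produces this transcript. The enlarged set decouples the two outputs, as
      \<open>card_correct_pairs_le\<close> requires.\<close>
    define G where "G t = {(x, y) \<in> ?B \<times> ?B.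
      out_A P t r rA x \<bowtie> out_B P t r rB y = map Some (XOR_fun n x y)}" for t
    \<comment> \<open>\<open>cost\<close> sees only coins in the support, which is why
      \<open>\<omega>\<close> is taken from \<open>set_pmf\<close>.\<close>
    have "length (transcript P r rA rB x y) \<le> c" if "x \<in> ?B" "y \<in> ?B" for x y
    proof -
      have "enat (length (transcript P r rA rB x y)) \<le> cost ?B ?B P"
        unfolding cost_def using that \<omega> w by (intro Sup_upper) fastforce
      then show ?thesis using cost by (metis enat_ord_simps(1) order_trans)
    qed
    then have "{i \<in> ?B \<times> ?B. \<omega> \<in> E i} \<subseteq> (\<Union>t\<in>{t. length t \<le> c}. G t)"
      by (auto simp: E_def w G_def split_model_def Let_def)
    moreover have fin: "finite {t :: bool list. length t \<le> c}"
      using finite_lists_length_le[of "UNIV :: bool set" c] by simp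
    moreover have "finite (G t)" for t
      by (rule finite_subset[of _ "?B \<times> ?B"]) (auto simp: G_def bitstrings_finite)
    ultimately have "card {i \<in> ?B \<times> ?B. \<omega> \<in> E i} \<le> card (\<Union>t\<in>{t. length t \<le> c}. G t)"
      by (intro card_mono) auto
    also have "\<dots> \<le> (\<Sum>t | length t \<le> c. card (G t))"
      by (rule card_UN_le[OF fin])
    also have "\<dots> \<le> card {t :: bool list. length t \<le> c} * (2 * (2 ^ n * 2 ^ (n div 2)))"
    proof -
      have "card (G t) \<le> 2 * (2 ^ n * 2 ^ (n div 2))" for t
        unfolding G_def using P
        by (intro card_correct_pairs_le) (auto simp: computes_def split_model_def)
      then show ?thesis
        using sum_bounded_above[of "{t :: bool list. length t \<le> c}" "\<lambda>t. card (G t)"] by simp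
    qed
    also have "\<dots> \<le> N"
      unfolding N_def by (intro mult_right_mono card_short_bitstrings) simp
    finally show ?thesis .
  qed
  then have "(\<Sum>i\<in>?B \<times> ?B. measure_pmf.prob ?p (E i)) \<le> real N"
    by (intro sum_prob_le) (auto simp: bitstrings_finite)
  moreover have "(\<Sum>i\<in>?B \<times> ?B. measure_pmf.prob ?p (E i)) \<ge> (\<Sum>i\<in>?B \<times> ?B. 1 / 2)"
  proof (rule sum_mono)
    fix i assume "i \<in> ?B \<times> ?B"
    then obtain x y where i: "i = (x, y)" "x \<in> ?B" "y \<in> ?B" by auto
    have "measure_pmf.prob ?p (E i) = success_prob (split_model n) (XOR_fun n) P x y"
      by (simp add: success_prob_def E_def i(1))
    also have "\<dots> \<ge> 1 - \<epsilon>" using P i by (auto simp: computes_def)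
    finally show "measure_pmf.prob ?p (E i) \<ge> 1 / 2" using assms(1) by simp
  qed
  ultimately have "real (2 ^ n * 2 ^ n) \<le> real (2 * N)"
    by (simp add: card_cartesian_product card_bitstrings)
  \<comment> \<open>The 3 collects \<open>c + 1\<close> from the number of transcripts, one factor 2
    for the two players and one for the success probability 1/2.\<close>
  then have "(2::nat) ^ (n + n) \<le> 2 ^ (c + 3 + n + n div 2)"
    unfolding of_nat_le_iff N_def by (simp add: power_add algebra_simps)
  then have "n + n \<le> c + 3 + n + n div 2"
    by (simp only: power_increasing_iff one_less_numeral_iff semiring_norm)
  then show ?thesis by linarith
qed

text \<open>Finiteness matters because \<open>real_of_ereal\<close> sends infinity to 0, which would
  spoil the asymptotic bound. It follows from the chain of inequalities and
  \<open>R_xor_XOR\<close>; an optimal protocol then yields the lower bound.\<close>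

lemma R_spt_XOR_bounds:
  assumes "0 < \<epsilon>" and "\<epsilon> < 1 / 2"
  obtains c where "R_spt (bitstrings n) (bitstrings n) n (XOR_fun n) \<epsilon> = enat c" "n \<le> 2 * c + 6"
proof -
  let ?B = "bitstrings n"
  have "R_spt ?B ?B n (XOR_fun n) \<epsilon> \<le> R_xor ?B ?B n (XOR_fun n) \<epsilon> + enat n"
    using R_spt_le_R_oot[OF XOR_fun_in] R_oot_le_R_uni[OF XOR_fun_in] R_uni_le_R_xor[OF XOR_fun_in]
    by (rule order_trans[OF order_trans])
  then have "R_spt ?B ?B n (XOR_fun n) \<epsilon> \<le> enat n"
    using assms by (simp add: R_xor_XOR)
  then obtain c where c: "R_spt ?B ?B n (XOR_fun n) \<epsilon> = enat c"
    using enat_ile by blast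
  then obtain P where "computes ?B ?B (split_model n) (XOR_fun n) \<epsilon> P" "cost ?B ?B P = enat c"
    by (metis R_attained R_spt_def enat.distinct(1))
  then have "n \<le> 2 * c + 6" using assms(2) by (intro cost_split_XOR_ge) auto
  with c show thesis by (rule that)
qed

theorem mainTheorem13:
  fixes \<epsilon> :: real
  assumes "0 < \<epsilon>" and "\<epsilon> < 1 / 2"
  shows "(\<forall>(X :: 'x set) (Y :: 'y set) (k :: nat) f. f \<in> X \<rightarrow> Y \<rightarrow> bitstrings k \<longrightarrow>
            R_xor X Y k f \<epsilon> \<le> R_spt X Y k f \<epsilon> \<and>
            R_spt X Y k f \<epsilon> \<le> R_oot X Y k f \<epsilon> \<and>
            R_oot X Y k f \<epsilon> \<le> R_uni X Y k f \<epsilon> \<and>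
            R_uni X Y k f \<epsilon> \<le> R_xor X Y k f \<epsilon> + enat k) \<and>
         (\<forall>n. D_xor (bitstrings n) (bitstrings n) n (XOR_fun n) = 0) \<and>
         (\<lambda>n. real_of_ereal (ereal_of_enat
            (R_spt (bitstrings n) (bitstrings n) n (XOR_fun n) \<epsilon>))) \<in> \<Omega>(\<lambda>n. real n)"
proof (intro conjI allI impI)
  fix X :: "'x set" and Y :: "'y set" and k f
  assume f: "f \<in> X \<rightarrow> Y \<rightarrow> bitstrings k"
  show "R_xor X Y k f \<epsilon> \<le> R_spt X Y k f \<epsilon>" by (rule R_xor_le_R_spt[OF f])
  show "R_spt X Y k f \<epsilon> \<le> R_oot X Y k f \<epsilon>" by (rule R_spt_le_R_oot[OF f])
  show "R_oot X Y k f \<epsilon> \<le> R_uni X Y k f \<epsilon>" by (rule R_oot_le_R_uni[OF f])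
  show "R_uni X Y k f \<epsilon> \<le> R_xor X Y k f \<epsilon> + enat k" by (rule R_uni_le_R_xor[OF f])
next
  show "D_xor (bitstrings n) (bitstrings n) n (XOR_fun n) = 0" for n
    by (simp add: D_xor_def R_xor_XOR)
next
  let ?R = "\<lambda>n. real_of_ereal (ereal_of_enat
    (R_spt (bitstrings n) (bitstrings n) n (XOR_fun n) \<epsilon>))"
  \<comment> \<open>From \<open>n \<le> 2 * c + 6\<close> follows
    \<open>4 * c \<ge> 2 * n - 12\<close>, and this is at least \<open>n\<close> once
    \<open>n \<ge> 12\<close>.\<close>
  have "norm (real n) \<le> 4 * norm (?R n)" if "n \<ge> 12" for n
    by (rule R_spt_XOR_bounds[OF assms, of n]) (use that in simp)
  then have "\<forall>\<^sub>F n in at_top. norm (real n) \<le> 4 * norm (?R n)"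
    by (intro eventually_at_top_linorderI[of 12])
  then have "(\<lambda>n. real n) \<in> O(?R)" by (rule bigoI)
  then show "?R \<in> \<Omega>(\<lambda>n. real n)" by (simp add: bigomega_iff_bigo)
qed

end
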